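(* Let $n\in\mathbb{N}$, and let $0<t<1$ if $n=1$ and $0<t\leq1$ if $n\geq2$. Then $$ \begin{aligned} \sum_{k=1}^{\infty}\frac{H_{k-1}t^k}{\binom{n+k}{k}}={}&f_0(t)+f_1(t)\sum_{k=1}^{n}\frac{1}{k}\left(\frac{t-1}{t}\right)^k-f_2(t)\sum_{k=1}^{n}\left(\frac{t-1}{t}\right)^k\\ &-f_3(t)\sum_{k=1}^{n}k\left(\frac{t-1}{t}\right)^k+f_4(t)\sum_{k=1}^{n}H_k\left(\frac{t-1}{t}\right)^k\\ &+f_5(t)\sum_{k=1}^{n}kH_k\left(\frac{t-1}{t}\right)^k-\frac{t}{(1-t)^2}\sum_{k=1}^{n}\frac{H_k}{k}\left(\frac{t-1}{t}\right)^k\\ &+\frac{t}{(1-t)^2}\sum_{p=0}^{n-1}\left\{\sum_{k=1}^{n-p}\left(\frac{H_{p+k}-H_k}{(p+k)k}+\frac{1}{k^2(p+k)}\right)\right\}p\left(\frac{t-1}{t}\right)^p\\ &-\frac{1}{(1-t)^2}\sum_{p=0}^{n-1}\left\{\sum_{k=1}^{n-p}\left(\frac{H_{p+k}-H_k}{(p+k)k}+\frac{1}{k^2(p+k)}\right)\right\}p^2\left(\frac{t-1}{t}\right)^p, \end{aligned} $$ where $$ f_0(t)=-\frac{t\log(1-t)}{1-t},\quad f_1(t)=\frac{t\log(1-t)-t^2}{(1-t)^2},\quad f_2(t)=\frac{4t\log(1-t)-t\log^2(1-t)}{2(1-t)^2}, $$ $$ f_3(t)=\frac{\log^2(1-t)}{2(1-t)^2},\quad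 f_4(t)=\frac{2t-t\log(1-t)}{(1-t)^2},\quad f_5(t)=\frac{\log(1-t)}{(1-t)^2}, $$ and where for $t=1$ (allowed only if $n\ge2$) the whole right-hand side is understood as its limit as $t\to1^-$.
   Context: $\mathbb{N}=\{1,2,3,\dots\}$. $H_m=\sum_{j=1}^m \frac1j$ is the $m$-th harmonic number, with $H_0=0$. $\log^2 x$ means $(\log x)^2$. Infinite series are limits of partial sums. *)

theory Defs
  imports "HOL-Analysis.Analysis"
begin

definition f0 :: "real \<Rightarrow> real" where
  "f0 t = - (t * ln (1 - t) / (1 - t))"

definition f1 :: "real \<Rightarrow> real" where
  "f1 t = (t * ln (1 - t) - t^2) / (1 - t)^2"

definition f2 :: "real \<Rightarrow> real" where
  "f2 t = (4 * t * ln (1 - t) - t * (ln (1 - t))^2) / (2 * (1 - t)^2)"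

definition f3 :: "real \<Rightarrow> real" where
  "f3 t = (ln (1 - t))^2 / (2 * (1 - t)^2)"

definition f4 :: "real \<Rightarrow> real" where
  "f4 t = (2 * t - t * ln (1 - t)) / (1 - t)^2"

definition f5 :: "real \<Rightarrow> real" where
  "f5 t = ln (1 - t) / (1 - t)^2"

definition inner_sum :: "nat \<Rightarrow> nat \<Rightarrow> real" where
  "inner_sum n p =
     (\<Sum>k=1..n - p. (harm (p + k) - harm k) / (real (p + k) * real k)
                   + 1 / ((real k)^2 * real (p + k)))"

text \<open>The closed form as written; only meaningful for \<open>0 < t < 1\<close>. Its value at \<open>t = 1\<close> in
  Isabelle/HOL is an artefact of division by zero and \<open>ln 0\<close>; use its left limit there.\<close>

definition closed_form :: "nat \<Rightarrow> real \<Rightarrow> real" where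
  "closed_form n t =
     f0 t
     + f1 t * (\<Sum>k=1..n. 1 / real k * ((t - 1) / t)^k)
     - f2 t * (\<Sum>k=1..n. ((t - 1) / t)^k)
     - f3 t * (\<Sum>k=1..n. real k * ((t - 1) / t)^k)
     + f4 t * (\<Sum>k=1..n. harm k * ((t - 1) / t)^k)
     + f5 t * (\<Sum>k=1..n. real k * harm k * ((t - 1) / t)^k)
     - t / (1 - t)^2 * (\<Sum>k=1..n. harm k / real k * ((t - 1) / t)^k)
     + t / (1 - t)^2 * (\<Sum>p=0..n - 1. inner_sum n p * real p * ((t - 1) / t)^p)
     - 1 / (1 - t)^2 * (\<Sum>p=0..n - 1. inner_sum n p * (real p)^2 * ((t - 1) / t)^p)"

definition series_term :: "nat \<Rightarrow> real \<Rightarrow> nat \<Rightarrow> real" where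
  "series_term n t k = harm (k - 1) * t^k / real ((n + k) choose k)"

end

theory Submission
  imports Defs "HOL-Real_Asymp.Real_Asymp"
begin

text \<open>
  Write \<open>F\<^sub>n(t)\<close> for the series and put \<open>W\<^sub>n(t) = t\<^sup>n F\<^sub>n(t)\<close>. The coefficient of \<open>t\<^sup>m\<close> in
  \<open>W\<^sub>n\<close> is \<open>H\<close> of index \<open>m - n - 1\<close> divided by \<open>m choose n\<close>, and since
  \<open>(m + 1) / ((m + 1) choose (n + 1)) = (n + 1) / (m choose n)\<close>, termwise differentiation gives
  \<open>W\<^sub>n\<^sub>+\<^sub>1' = (n + 1) W\<^sub>n\<close>, with \<open>W\<^sub>n(0) = 0\<close>. The chain starts at the classical generating function
  \<open>W\<^sub>0(t) = \<Sum> H\<^sub>m\<^sub>-\<^sub>1 t\<^sup>m = - t log(1 - t) / (1 - t)\<close>. So \<open>W\<^sub>n\<close> is \<open>n!\<close> times the \<open>n\<close>-fold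
  repeated integral of \<open>W\<^sub>0\<close>. For \<open>n \<ge> 1\<close> these integrals are quadratic in \<open>log(1 - t)\<close> with
  polynomial coefficients. The explicit formula is \<open>primitive\<close>, and it is confirmed by
  checking the same differential recursion (\<open>DERIV_primitive_0\<close>, \<open>DERIV_primitive_Suc\<close>), which
  yields \<open>sums_series_term\<close>.

  The closed form is \<open>W\<^sub>n(t) / t\<^sup>n\<close> in disguise. With \<open>u = (t - 1) / t\<close> one has \<open>t (1 - u) = 1\<close>, so
  summation by parts (\<open>sum_by_parts\<close>) turns \<open>t\<close> times a sum of differences into a sum without
  the factor \<open>t\<close>. In this way the sums in the closed form cancel, up to boundary terms with
  \<open>u\<^sup>n\<^sup>+\<^sup>1\<close>, which carry the logarithms, and one sum left by the double sums, which is the polynomial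
  sum in \<open>primitive\<close>. The double sums can be treated by parts because \<open>p\<close> times the inner
  sum telescopes (\<open>inner_sum_telescoped\<close>), so that consecutive values differ by a simple
  expression (\<open>inner_sum_difference\<close>). The comparison is \<open>closed_form_eq_primitive\<close>.

  For \<open>n \<ge> 2\<close> every power of \<open>log(1 - t)\<close> in \<open>W\<^sub>n\<close> is multiplied by \<open>t - 1\<close>, so the closed form has a
  limit at \<open>1\<close> from the left. As the coefficients of the series are nonnegative, partial sums
  can be compared with the values for \<open>t < 1\<close>, and the series at \<open>t = 1\<close> has that limit as its sum
  (\<open>sums_at_1_if_tendsto\<close>).
\<close>

section \<open>Repeated integrals of the generating function\<close>

text \<open>
  This is \<open>(m + 1)!\<close> times the \<open>(m + 1)\<close>-fold repeated integral from \<open>0\<close> of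
  \<open>- z log(1 - z) / (1 - z)\<close>. The index is shifted by one because the zeroth member of the
  family, the integrand itself, does not have this shape.
\<close>

definition primitive :: "nat \<Rightarrow> real \<Rightarrow> real" where
  "primitive m z =
     (z - 1)^m * (real (Suc m) / 2 * (ln (1 - z))^2
                  + (z - real (Suc m) * harm (Suc m)) * ln (1 - z) - z * harm (Suc m))
     + (\<Sum>j=1..m. (real (Suc m) - real j) / real j * (harm (Suc m) - harm (j - 1))
                   * ((z - 1)^(m - j) * z^j))"

lemma DERIV_primitive_0:
  assumes "z < 1"
  shows "(primitive 0 has_real_derivative (- (z * ln (1 - z) / (1 - z)))) (at z)"
proof -
  have eq: "primitive 0 = (\<lambda>z. (ln (1 - z))^2 / 2 + (z - 1) * ln (1 - z) - z)"
    by (rule ext) (simp add: primitive_def harm_def)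
  have "((\<lambda>z. (ln (1 - z))^2 / 2 + (z - 1) * ln (1 - z) - z) has_real_derivative
      (- (ln (1 - z) / (1 - z)) + (ln (1 - z) + 1) - 1)) (at z)"
    using assms by (auto intro!: derivative_eq_intros simp: divide_simps) (simp add: algebra_simps)
  also have "- (ln (1 - z) / (1 - z)) + (ln (1 - z) + 1) - 1 = - (z * ln (1 - z) / (1 - z))"
    using assms by (simp add: field_simps)
  finally show ?thesis
    unfolding eq .
qed

text \<open>
  The logarithmic part and the finite sum are differentiated separately. Each of them reproduces
  its own shape up to a remainder: \<open>- (z - 1)\<^sup>q (N - 1) H\<close> for the first, and the derivative of the
  power \<open>z\<^sup>1\<close> in the term \<open>j = 1\<close> for the second. The two remainders cancel.
\<close>

lemma DERIV_primitive_Suc: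
  assumes "z < 1"
  shows "(primitive (Suc q) has_real_derivative (real (q + 2) * primitive q z)) (at z)"
proof -
  define N where "N = real (q + 2)"
  define H :: real where "H = harm (q + 2)"
  define L where "L = ln (1 - z)"
  define c where "c = (\<lambda>j. (N - real j) / real j * (H - harm (j - 1)))"
  define d where "d = (\<lambda>j. (N - 1 - real j) / real j * (harm (Suc q) - harm (j - 1)))"
  have H': "harm (Suc q) = H - 1 / N"
    by (simp add: H_def N_def harm_Suc inverse_eq_divide add_ac)
  have N0: "N > 0" by (simp add: N_def)
  have prim: "primitive (Suc q) = (\<lambda>x. (x - 1)^Suc q * (N / 2 * (ln (1 - x))^2
                  + (x - N * H) * ln (1 - x) - x * H)
     + (\<Sum>j=1..Suc q. c j * ((x - 1)^(Suc q - j) * x^j)))"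
    by (rule ext) (simp add: primitive_def N_def H_def c_def algebra_simps)
  have primq: "primitive q z = (z - 1)^q * ((N - 1) / 2 * L^2
                  + (z - (N - 1) * harm (Suc q)) * L - z * harm (Suc q))
     + (\<Sum>j=1..q. d j * ((z - 1)^(q - j) * z^j))"
    by (simp add: primitive_def N_def L_def d_def algebra_simps)
  \<comment> \<open>The coefficient of \<open>(z - 1)\<^sup>q\<^sup>-\<^sup>j z\<^sup>j\<close> in the derivative collects the terms \<open>j\<close> and \<open>j + 1\<close>.\<close>
  have coeff: "c j * (N - 1 - real j) + c (Suc j) * real (Suc j) = N * d j" if "j \<ge> 1" for j
  proof -
    have h: "harm j = harm (j - 1) + 1 / real j"
      using that by (cases j) (auto simp: harm_Suc inverse_eq_divide)
    define K where "K = H - harm (j - 1)"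
    have j: "real j \<noteq> 0" using that by simp
    have "c (Suc j) * real (Suc j) = (N - real (Suc j)) * (H - harm j)"
      by (simp add: c_def del: of_nat_Suc)
    hence c_next: "c (Suc j) * real (Suc j) = (N - 1 - real j) * (K - 1 / real j)"
      by (simp add: h K_def algebra_simps)
    have d_j: "d j = (N - 1 - real j) / real j * (K - 1 / N)"
      by (simp add: d_def H' K_def)
    have c_j: "c j = (N - real j) / real j * K"
      by (simp add: c_def K_def)
    show ?thesis
      unfolding c_next d_j c_j using j N0 by (simp add: field_simps)
  qed
  have log_part: "((\<lambda>x. (x - 1)^Suc q * (N / 2 * (ln (1 - x))^2 + (x - N * H) * ln (1 - x) - x * H))
      has_real_derivative
        (z - 1)^q * (N * ((N - 1) / 2 * L^2 + (z - (N - 1) * harm (Suc q)) * L - z * harm (Suc q))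
                     - (N - 1) * H)) (at z)"
  proof -
    have A: "((\<lambda>x. N / 2 * (ln (1 - x))^2 + (x - N * H) * ln (1 - x) - x * H)
        has_real_derivative (N * L + z - N * H) / (z - 1) + L - H) (at z)"
      using assms unfolding L_def
      by (auto intro!: derivative_eq_intros simp: divide_simps) (simp add: algebra_simps)
    have B: "((\<lambda>x. (x - 1)^Suc q) has_real_derivative (real (Suc q) * (z - 1)^q)) (at z)"
    proof -
      have "((\<lambda>x. x - 1) has_real_derivative 1) (at z)" by (auto intro!: derivative_eq_intros)
      from DERIV_power_Suc[OF this, of q] show ?thesis by simp
    qed
    have C: "((N * L + z - N * H) / (z - 1) + L - H) * (z - 1)^Suc q
        = (z - 1)^q * (N * L + z - N * H + (L - H) * (z - 1))"
      using assms by (simp add: field_simps)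
    have "real (Suc q) * (z - 1)^q * (N / 2 * L^2 + (z - N * H) * L - z * H)
        + ((N * L + z - N * H) / (z - 1) + L - H) * (z - 1)^Suc q
      = (z - 1)^q * ((N - 1) * (N / 2 * L^2 + (z - N * H) * L - z * H)
          + (N * L + z - N * H + (L - H) * (z - 1)))"
      unfolding C distrib_left by (simp add: N_def)
    also have "(N - 1) * (N / 2 * L^2 + (z - N * H) * L - z * H)
          + (N * L + z - N * H + (L - H) * (z - 1))
      = N * ((N - 1) / 2 * L^2 + (z - (N - 1) * harm (Suc q)) * L - z * harm (Suc q)) - (N - 1) * H"
      unfolding H' using N0 by (simp add: field_simps)
    finally show ?thesis
      using DERIV_mult[OF B A] by (simp add: L_def)
  qed
  have deriv_mono: "((\<lambda>x. (x - 1)^k * x^j) has_real_derivative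
      (real k * (z - 1)^(k - 1) * z^j + real j * z^(j - 1) * (z - 1)^k)) (at z)" for k j
  proof -
    have "((\<lambda>x. x - 1) has_real_derivative 1) (at z)" by (auto intro!: derivative_eq_intros)
    from DERIV_mult[OF DERIV_power[OF this, of k] DERIV_power[OF DERIV_ident, of j]]
    show ?thesis by (simp add: mult_ac add_ac)
  qed
  have sum_part: "((\<lambda>x. \<Sum>j=1..Suc q. c j * ((x - 1)^(Suc q - j) * x^j))
      has_real_derivative (z - 1)^q * ((N - 1) * H)
        + N * (\<Sum>j=1..q. d j * ((z - 1)^(q - j) * z^j))) (at z)"
  proof -
    have "((\<lambda>x. \<Sum>j=1..Suc q. c j * ((x - 1)^(Suc q - j) * x^j)) has_real_derivative
        (\<Sum>j=1..Suc q. c j * (real (Suc q - j) * (z - 1)^(Suc q - j - 1) * z^j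
                               + real j * z^(j - 1) * (z - 1)^(Suc q - j)))) (at z)"
      by (intro DERIV_sum DERIV_cmult deriv_mono)
    also have "(\<Sum>j=1..Suc q. c j * (real (Suc q - j) * (z - 1)^(Suc q - j - 1) * z^j
                               + real j * z^(j - 1) * (z - 1)^(Suc q - j)))
      = (\<Sum>j=1..Suc q. c j * (real (Suc q - j) * (z - 1)^(Suc q - j - 1) * z^j))
        + (\<Sum>j=1..Suc q. c j * (real j * z^(j - 1) * (z - 1)^(Suc q - j)))"
      by (simp add: distrib_left sum.distrib)
    also have "(\<Sum>j=1..Suc q. c j * (real (Suc q - j) * (z - 1)^(Suc q - j - 1) * z^j))
      = (\<Sum>j=1..q. c j * (N - 1 - real j) * ((z - 1)^(q - j) * z^j))"
      by (auto simp: N_def of_nat_diff Suc_diff_le intro!: sum.cong)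
    also have "(\<Sum>j=1..Suc q. c j * (real j * z^(j - 1) * (z - 1)^(Suc q - j)))
      = (\<Sum>i=0..q. c (Suc i) * real (Suc i) * ((z - 1)^(q - i) * z^i))"
      by (rule sum.reindex_bij_witness[of _ Suc "\<lambda>j. j - 1"]) auto
    also have "\<dots> = (z - 1)^q * ((N - 1) * H)
        + (\<Sum>i=1..q. c (Suc i) * real (Suc i) * ((z - 1)^(q - i) * z^i))"
      by (subst sum.atLeast_Suc_atMost) (auto simp: c_def harm_def)
    also have "(\<Sum>j=1..q. c j * (N - 1 - real j) * ((z - 1)^(q - j) * z^j))
        + ((z - 1)^q * ((N - 1) * H)
           + (\<Sum>i=1..q. c (Suc i) * real (Suc i) * ((z - 1)^(q - i) * z^i)))
      = (z - 1)^q * ((N - 1) * H)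
        + (\<Sum>j=1..q. (c j * (N - 1 - real j) + c (Suc j) * real (Suc j)) * ((z - 1)^(q - j) * z^j))"
      by (simp add: distrib_right sum.distrib)
    also have "(\<Sum>j=1..q. (c j * (N - 1 - real j) + c (Suc j) * real (Suc j)) * ((z - 1)^(q - j) * z^j))
      = N * (\<Sum>j=1..q. d j * ((z - 1)^(q - j) * z^j))"
      unfolding sum_distrib_left by (intro sum.cong refl) (simp add: coeff del: of_nat_Suc)
    finally show ?thesis .
  qed
  have deriv_eq: "real (q + 2) * primitive q z
      = (z - 1)^q * (N * ((N - 1) / 2 * L^2 + (z - (N - 1) * harm (Suc q)) * L - z * harm (Suc q))
                     - (N - 1) * H)
        + ((z - 1)^q * ((N - 1) * H) + N * (\<Sum>j=1..q. d j * ((z - 1)^(q - j) * z^j)))"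
    unfolding primq N_def[symmetric] by (simp add: algebra_simps)
  show ?thesis
    unfolding prim deriv_eq by (rule DERIV_add[OF log_part sum_part])
qed

lemma primitive_at_0: "primitive m 0 = 0"
  by (auto simp: primitive_def intro!: sum.neutral)

section \<open>Power series of the shifted sums\<close>

text \<open>
  The coefficients of \<open>t\<^sup>n\<close> times the series. Truncated subtraction makes them vanish for
  \<open>m \<le> n + 1\<close>, as \<open>harm 0 = 0\<close>, which also covers the indices with \<open>m choose n = 0\<close>.
\<close>

definition shifted_coeff :: "nat \<Rightarrow> nat \<Rightarrow> real" where
  "shifted_coeff n m = harm (m - n - 1) / real (m choose n)"

lemma shifted_coeff_eq_0: "m \<le> Suc n \<Longrightarrow> shifted_coeff n m = 0"
  by (simp add: shifted_coeff_def harm_def)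

lemma summable_shifted_coeff:
  fixes z :: real
  assumes "norm z < 1"
  shows "summable (\<lambda>m. shifted_coeff n m * z^m)"
proof (rule summable_comparison_test')
  show "summable (\<lambda>m. real (Suc m) * norm z^m)"
    using geometric_deriv_sums[of "norm z"] assms by (auto simp: sums_iff)
  fix m :: nat
  have harm_le: "harm k \<le> real k" for k
  proof (induction k)
    case (Suc k)
    have "inverse (real (Suc k)) \<le> 1" by (simp add: inverse_eq_divide)
    thus ?case using Suc by (simp add: harm_Suc)
  qed (simp add: harm_def)
  have "shifted_coeff n m \<le> real (Suc m)"
  proof (cases "m choose n = 0")
    case False
    hence "1 \<le> real (m choose n)" by (simp add: Suc_leI)
    hence "shifted_coeff n m \<le> harm (m - n - 1)"
      using frac_le[of "harm (m - n - 1)" "harm (m - n - 1)" 1 "real (m choose n)"]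
      by (simp add: shifted_coeff_def harm_nonneg)
    thus ?thesis using harm_le[of "m-n-1"] by linarith
  qed (simp add: shifted_coeff_def binomial_eq_0)
  moreover have "shifted_coeff n m \<ge> 0" by (simp add: shifted_coeff_def harm_nonneg)
  ultimately show "norm (shifted_coeff n m * z ^ m) \<le> real (Suc m) * norm z ^ m"
    by (simp add: abs_mult power_abs mult_right_mono del: of_nat_Suc)
qed

text \<open>
  Multiplying the series by \<open>t\<^sup>n\<close> is what makes differentiation lower \<open>n\<close>: the factor \<open>m + 1\<close> is
  absorbed by the binomial coefficient.
\<close>

lemma diffs_shifted_coeff: "diffs (shifted_coeff (Suc n)) m = real (Suc n) * shifted_coeff n m"
proof -
  have "real (Suc m) * real (m choose n) = real (Suc n) * real (Suc m choose Suc n)"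
    by (metis Suc_times_binomial of_nat_mult)
  thus ?thesis
    by (cases "m < n") (auto simp: diffs_def shifted_coeff_def divide_simps simp del: of_nat_Suc binomial_Suc_Suc)
qed

text \<open>
  Multiplying by \<open>1 - z\<close> replaces the harmonic numbers by their differences \<open>1 / m\<close>, which
  leaves the series of \<open>- z log(1 - z)\<close>.
\<close>

lemma sums_shifted_coeff_0:
  fixes z :: real
  assumes "norm z < 1"
  shows "(\<lambda>m. shifted_coeff 0 m * z^m) sums (- (z * ln (1 - z) / (1 - z)))"
proof -
  define s where "s = (\<Sum>m. shifted_coeff 0 m * z^m)"
  have s: "(\<lambda>m. shifted_coeff 0 m * z^m) sums s"
    unfolding s_def using summable_shifted_coeff[OF assms] by (rule summable_sums)
  have s1: "(\<lambda>m. shifted_coeff 0 (Suc m) * z^Suc m) sums s"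
    using s by (subst sums_Suc_iff) (simp add: shifted_coeff_def harm_def)
  have "(\<lambda>m. shifted_coeff 0 (Suc m) * z^Suc m - z * (shifted_coeff 0 m * z^m)) sums (s - z * s)"
    by (intro sums_diff s1 sums_mult s)
  moreover have "shifted_coeff 0 (Suc m) * z^Suc m - z * (shifted_coeff 0 m * z^m) = z * (z^m / real m)" for m
    by (cases m) (auto simp: shifted_coeff_def harm_Suc harm_def[of 0] field_simps)
  moreover have "(\<lambda>m. z * (z^m / real m)) sums (z * (- ln (1 - z)))"
    using ln_series'[of "-z"] assms by (intro sums_mult) (auto dest: sums_minus)
  ultimately have "s - z * s = - (z * ln (1 - z))"
    by (auto dest: sums_unique2)
  hence "s = - (z * ln (1 - z) / (1 - z))"
    using assms by (auto simp: field_simps)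
  thus ?thesis using s by simp
qed

lemma eq_if_same_derivative:
  fixes f g f' :: "real \<Rightarrow> real"
  assumes "\<And>x. norm x < 1 \<Longrightarrow> (f has_real_derivative f' x) (at x)"
    and "\<And>x. norm x < 1 \<Longrightarrow> (g has_real_derivative f' x) (at x)"
    and "f 0 = g 0" and "norm z < 1"
  shows "f z = g z"
proof -
  have "((\<lambda>x. f x - g x) has_real_derivative 0) (at x within ball 0 1)" if "x \<in> ball 0 1" for x
    using DERIV_diff[OF assms(1,2)[of x]] that by (auto intro: has_field_derivative_at_within)
  then obtain c where "\<And>x. x \<in> ball 0 1 \<Longrightarrow> f x - g x = c"
    using has_field_derivative_zero_constant[of "ball 0 (1::real)" "\<lambda>x. f x - g x"] by auto
  from this[of z] this[of 0] show ?thesis using assms by simp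
qed

text \<open>
  Integrating the power series termwise from \<open>0\<close>: both sides vanish at \<open>0\<close>, and by
  \<open>diffs_shifted_coeff\<close> they have the same derivative.
\<close>

lemma sums_shifted_coeff_step:
  assumes deriv: "\<And>x. norm x < 1 \<Longrightarrow> (g has_real_derivative (real (Suc n) * h x)) (at x)"
    and sums: "\<And>x. norm x < 1 \<Longrightarrow> (\<lambda>m. shifted_coeff n m * x^m) sums h x"
    and "g 0 = 0" and z: "norm z < 1"
  shows "(\<lambda>m. shifted_coeff (Suc n) m * z^m) sums g z"
proof -
  have "((\<lambda>z. \<Sum>m. shifted_coeff (Suc n) m * z^m) has_real_derivative (real (Suc n) * h x)) (at x)"
    if x: "norm x < 1" for x
  proof -
    have "(\<Sum>m. diffs (shifted_coeff (Suc n)) m * x^m) = real (Suc n) * h x"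
      using sums_mult[OF sums[OF x], of "real (Suc n)"]
      by (simp add: diffs_shifted_coeff sums_iff mult.assoc del: of_nat_Suc)
    thus ?thesis
      using termdiffs_strong'[of 1 "shifted_coeff (Suc n)" x, OF summable_shifted_coeff x] by simp
  qed
  hence "(\<Sum>m. shifted_coeff (Suc n) m * z^m) = g z"
  proof (rule eq_if_same_derivative[where f = "\<lambda>z. \<Sum>m. shifted_coeff (Suc n) m * z^m"
          and f' = "\<lambda>x. real (Suc n) * h x", OF _ deriv _ z])
    have "(\<Sum>m. shifted_coeff (Suc n) m * 0^m) = shifted_coeff (Suc n) 0"
      by (rule powser_zero)
    thus "(\<Sum>m. shifted_coeff (Suc n) m * 0^m) = g 0"
      using assms(3) by (simp add: shifted_coeff_eq_0)
  qed
  thus ?thesis using summable_shifted_coeff[OF z] by (simp add: sums_iff)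
qed

lemma sums_shifted_coeff_Suc:
  fixes z :: real
  assumes "norm z < 1"
  shows "(\<lambda>m. shifted_coeff (Suc q) m * z^m) sums primitive q z"
  using assms
proof (induction q arbitrary: z)
  case (0 z)
  show ?case
  proof (rule sums_shifted_coeff_step[where n = 0 and g = "primitive 0"
        and h = "\<lambda>x. - (x * ln (1 - x) / (1 - x))", OF _ sums_shifted_coeff_0 primitive_at_0 0])
    fix x :: real assume "norm x < 1"
    thus "(primitive 0 has_real_derivative (real (Suc 0) * - (x * ln (1 - x) / (1 - x)))) (at x)"
      using DERIV_primitive_0[of x] by simp
  qed
next
  case (Suc q z)
  show ?case
  proof (rule sums_shifted_coeff_step[where n = "Suc q" and g = "primitive (Suc q)"
        and h = "primitive q", OF _ Suc.IH primitive_at_0 Suc.prems])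
    fix x :: real assume "norm x < 1"
    thus "(primitive (Suc q) has_real_derivative (real (Suc (Suc q)) * primitive q x)) (at x)"
      using DERIV_primitive_Suc[of x q] by simp
  qed
qed

lemma sums_series_term:
  assumes "0 < t" "t < 1"
  shows "(\<lambda>k. series_term (Suc q) t (Suc k)) sums (primitive q t / t^Suc q)"
proof -
  have "(\<lambda>m. shifted_coeff (Suc q) (m + (q + 2)) * t^(m + (q + 2))) sums primitive q t"
  proof (subst sums_iff_shift)
    have "(\<Sum>m<q + 2. shifted_coeff (Suc q) m * t^m) = 0"
      by (intro sum.neutral) (auto simp: shifted_coeff_eq_0)
    thus "(\<lambda>m. shifted_coeff (Suc q) m * t^m) sums
            (primitive q t + (\<Sum>m<q + 2. shifted_coeff (Suc q) m * t^m))"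
      using sums_shifted_coeff_Suc[of t q] assms by simp
  qed
  hence "(\<lambda>k. shifted_coeff (Suc q) (k + (q + 2)) * t^(k + (q + 2)) / t^Suc q)
           sums (primitive q t / t^Suc q)"
    by (rule sums_divide)
  moreover have "shifted_coeff (Suc q) (k + (q + 2)) * t^(k + (q + 2)) / t^Suc q
      = series_term (Suc q) t (Suc k)" for k
  proof -
    have "(k + (q + 2)) choose (Suc q) = (Suc q + Suc k) choose (Suc k)"
      using binomial_symmetric[of "Suc q" "k + (q + 2)"] by (simp add: add_ac del: binomial_Suc_Suc)
    moreover have "t^(k + (q + 2)) = t^Suc q * t^Suc k"
      unfolding power_add[symmetric] by (simp add: add_ac)
    ultimately show ?thesis
      using assms by (simp add: shifted_coeff_def series_term_def del: binomial_Suc_Suc power_Suc)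
  qed
  ultimately show ?thesis by (simp only:)
qed

section \<open>Finite summation identities\<close>

lemma sum_by_parts:
  fixes b :: "nat \<Rightarrow> 'a::comm_ring_1"
  assumes "t * (1 - u) = 1"
  shows "(\<Sum>k=1..n. b k * u^k)
       = t * (\<Sum>k=1..n. (b k - b (k - 1)) * u^k) - t * b n * u^Suc n + t * b 0 * u"
proof (induction n)
  case (Suc n)
  have "(\<Sum>k=1..Suc n. b k * u^k) = (\<Sum>k=1..n. b k * u^k) + t * (1 - u) * (b (Suc n) * u^Suc n)"
    by (simp add: assms)
  thus ?case
    unfolding Suc.IH by (simp add: algebra_simps)
qed simp

text \<open>
  Since \<open>p / ((p + k) k) = 1 / k - 1 / (p + k)\<close>, the mixed terms of \<open>p\<close> times the \<open>k\<close>-th summand are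
  \<open>H\<^sub>p\<^sub>+\<^sub>k / k + H\<^sub>k\<^sub>-\<^sub>1 / (p + k) = H\<^sub>k H\<^sub>p\<^sub>+\<^sub>k - H\<^sub>k\<^sub>-\<^sub>1 H\<^sub>p\<^sub>+\<^sub>k\<^sub>-\<^sub>1\<close>,
  which telescopes.
\<close>

lemma inner_sum_telescoped:
  "real p * inner_sum n p =
     harm n * harm (n - p) - (\<Sum>m\<in>{p<..n}. harm m / real m) - (\<Sum>k=1..n-p. harm (k - 1) / real k)"
  if "p \<le> n"
proof -
  define f where "f = (\<lambda>k. (harm (p + k) - harm k) / (real (p + k) * real k)
                           + 1 / ((real k)^2 * real (p + k)))"
  have "real p * sum f {1..N}
     = harm (p + N) * harm N - (\<Sum>m\<in>{p<..p+N}. harm m / real m) - (\<Sum>k=1..N. harm (k - 1) / real k)"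
    for N
  proof (induction N)
    case 0 show ?case by (simp add: harm_def)
  next
    case (Suc N)
    have "{p<..p + Suc N} = insert (p + Suc N) {p<..p + N}" by auto
    moreover have "real p * f (Suc N)
       = harm (p + Suc N) * harm (Suc N) - harm (p + N) * harm N
         - harm (p + Suc N) / real (p + Suc N) - harm N / real (Suc N)"
    proof -
      have "harm (p + N) = harm (p + Suc N) - 1 / real (p + Suc N)"
           "harm N = harm (Suc N) - (1::real) / real (Suc N)"
        by (simp_all add: harm_Suc inverse_eq_divide)
      moreover have "real p = real (p + Suc N) - real (Suc N)" by simp
      moreover have "real (p + Suc N) \<noteq> 0" "real (Suc N) \<noteq> 0" by linarith+
      ultimately show ?thesis
        unfolding f_def
        by (simp only:) (simp add: field_simps power2_eq_square del: of_nat_Suc of_nat_add)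
    qed
    ultimately show ?case using Suc.IH by (simp add: distrib_left del: of_nat_Suc)
  qed
  from this[of "n - p"] that show ?thesis by (simp add: inner_sum_def f_def)
qed

lemma inner_sum_difference:
  assumes "1 \<le> p" "p \<le> n"
  shows "real p * inner_sum n p - real (p - 1) * inner_sum n (p - 1)
       = harm p / real p - (harm n - harm (n - p)) / real (n - p + 1)"
proof -
  obtain r where r: "p = Suc r" using assms by (cases p) auto
  have n: "n - r = Suc (n - Suc r)" using assms r by simp
  have set: "{r<..n} = insert (Suc r) {Suc r<..n}" using assms r by auto
  have "real p * inner_sum n p - real r * inner_sum n r
      = harm n * (harm (n - Suc r) - harm (n - r)) + harm (Suc r) / real (Suc r)
        + harm (n - Suc r) / real (n - r)"
    using inner_sum_telescoped[of p n] inner_sum_telescoped[of r n] assms unfolding r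
    by (simp add: set n algebra_simps del: of_nat_Suc)
  also have "harm (n - Suc r) - harm (n - r) = - (1 / real (n - r))"
    by (simp add: n harm_Suc inverse_eq_divide)
  finally show ?thesis
    unfolding r by (simp add: n diff_divide_distrib del: of_nat_Suc)
qed

section \<open>The closed form\<close>

text \<open>
  Up to \<open>\<Sum> H\<^sub>k u\<^sup>k / k\<close>, all the sums over \<open>u\<^sup>k\<close> are reduced to \<open>\<Sum> u\<^sup>k / k\<close>, to \<open>u\<^sup>n\<^sup>+\<^sup>1\<close> and to the sum \<open>S\<close> that comes from
  the double sums. In the total the sum \<open>\<Sum> u\<^sup>k / k\<close> cancels, and \<open>\<Sum> H\<^sub>k u\<^sup>k / k\<close> cancels
  against the double sums; reversing the order of summation turns \<open>S\<close> into the finite sum of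
  \<open>primitive\<close>.
\<close>

lemma closed_form_eq_primitive:
  assumes "0 < t" "t < 1"
  shows "closed_form (Suc q) t = primitive q t / t^Suc q"
proof -
  define n where "n = Suc q"
  define u where "u = (t - 1) / t"
  define L where "L = ln (1 - t)"
  define H :: real where "H = harm n"
  define U where "U = u^Suc n"
  define J where "J = (\<lambda>p. (H - harm (n - p)) / real (n - p + 1))"
  define S where "S = (\<Sum>p=1..n. real (p - 1) * J p * u^p)"
  define A0 where "A0 = (\<Sum>k=1..n. u^k)"
  define A1 where "A1 = (\<Sum>k=1..n. 1 / real k * u^k)"
  define Ak where "Ak = (\<Sum>k=1..n. real k * u^k)"
  define AH where "AH = (\<Sum>k=1..n. harm k * u^k)"
  define AkH where "AkH = (\<Sum>k=1..n. real k * harm k * u^k)"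
  define AHk where "AHk = (\<Sum>k=1..n. harm k / real k * u^k)"
  define D1 where "D1 = (\<Sum>p=0..n - 1. inner_sum n p * real p * u^p)"
  define D2 where "D2 = (\<Sum>p=0..n - 1. inner_sum n p * (real p)^2 * u^p)"
  have tu: "t * (1 - u) = 1" and ut: "t * u = t - 1" and t0: "t \<noteq> 0" and t1: "1 - t \<noteq> 0"
    and u0: "u \<noteq> 0"
    using assms by (simp_all add: u_def field_simps)
  note parts = sum_by_parts[OF tu]

  have A0: "A0 = (t - 1) - t * U"
    using parts[of "\<lambda>_. 1" n] ut by (simp add: A0_def U_def)
  have Ak: "Ak = t * A0 - t * real n * U"
  proof -
    have "(\<Sum>k=1..n. (real k - real (k - 1)) * u^k) = A0"
      unfolding A0_def by (intro sum.cong) (auto simp: of_nat_diff)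
    thus ?thesis using parts[of real n] by (simp add: Ak_def U_def)
  qed
  have harm_step: "harm k - harm (k - 1) = (1 / real k :: real)" if "k \<ge> 1" for k
    using that by (cases k) (auto simp: harm_Suc inverse_eq_divide)
  have AH: "AH = t * A1 - t * H * U"
  proof -
    have "(\<Sum>k=1..n. (harm k - harm (k - 1)) * u^k) = A1"
      unfolding A1_def by (intro sum.cong refl) (subst harm_step, auto)
    thus ?thesis using parts[of harm n] by (simp add: AH_def U_def H_def harm_def[of 0])
  qed
  have AkH: "AkH = t * (AH + A0 - A1) - t * (real n * H) * U"
  proof -
    have "(real k * harm k - real (k - 1) * harm (k - 1)) * u^k
        = harm k * u^k + u^k - 1 / real k * u^k" if "k \<in> {1..n}" for k
    proof -
      have h: "harm (k - 1) = harm k - 1 / real k" using harm_step[of k] that by simp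
      have k: "real (k - 1) = real k - 1" using that by (simp add: of_nat_diff)
      have "real k * harm k - (real k - 1) * (harm k - 1 / real k) = (harm k + 1 - 1 / real k :: real)"
        using that by (simp add: field_simps)
      thus ?thesis unfolding h k by (simp only:) (simp add: algebra_simps)
    qed
    hence "(\<Sum>k=1..n. (real k * harm k - real (k - 1) * harm (k - 1)) * u^k) = AH + A0 - A1"
      by (simp add: AH_def A0_def A1_def sum.distrib sum_subtractf)
    thus ?thesis using parts[of "\<lambda>k. real k * harm k" n] by (simp add: AkH_def U_def H_def)
  qed

  have inner_sum_n: "inner_sum n n = 0" by (simp add: inner_sum_def)
  have shift: "(\<Sum>p=0..n - 1. inner_sum n p * c p * u^p) = (\<Sum>p=1..n. inner_sum n p * c p * u^p)"
    if "c 0 = 0" for c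
  proof -
    have "{0..n - 1} = insert 0 {1..q}" "{1..n} = insert n {1..q}"
      by (auto simp: n_def)
    thus ?thesis using that inner_sum_n by (simp add: n_def)
  qed
  have D1: "D1 = (\<Sum>p=1..n. inner_sum n p * real p * u^p)"
    unfolding D1_def by (rule shift) simp
  have D2: "D2 = (\<Sum>p=1..n. inner_sum n p * (real p)^2 * u^p)"
    unfolding D2_def by (rule shift) simp
  \<comment> \<open>By parts with \<open>b p = p\<^sup>2 * inner_sum n p\<close>, the two double sums combine into a sum over
    consecutive differences of \<open>p * inner_sum n p\<close>.\<close>
  have "D2 = t * (\<Sum>p=1..n. (inner_sum n p * (real p)^2
                  - inner_sum n (p - 1) * (real (p - 1))^2) * u^p)"
    unfolding D2 using parts[of "\<lambda>p. inner_sum n p * (real p)^2" n] by (simp add: inner_sum_n)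
  hence "t * D1 - D2 = t * D1 - t * (\<Sum>p=1..n. (inner_sum n p * (real p)^2
                  - inner_sum n (p - 1) * (real (p - 1))^2) * u^p)" by (simp only:)
  also have "\<dots> = t * (\<Sum>p=1..n. (inner_sum n p * real p - inner_sum n p * (real p)^2
                  + inner_sum n (p - 1) * (real (p - 1))^2) * u^p)"
    unfolding D1 right_diff_distrib[symmetric] sum_subtractf[symmetric]
    by (simp add: algebra_simps)
  also have "(\<Sum>p=1..n. (inner_sum n p * real p - inner_sum n p * (real p)^2
                  + inner_sum n (p - 1) * (real (p - 1))^2) * u^p)
      = (\<Sum>p=1..n. real (p - 1) * J p * u^p - (harm p * u^p - harm p / real p * u^p))"
  proof (rule sum.cong[OF refl])
    fix p assume p: "p \<in> {1..n}"
    have p1: "real (p - 1) = real p - 1" using p by (simp add: of_nat_diff)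
    have "inner_sum n p * real p - inner_sum n p * (real p)^2
            + inner_sum n (p - 1) * (real (p - 1))^2
        = - (real (p - 1) * (real p * inner_sum n p - real (p - 1) * inner_sum n (p - 1)))"
      unfolding p1 by (simp add: algebra_simps power2_eq_square)
    also have "real p * inner_sum n p - real (p - 1) * inner_sum n (p - 1) = harm p / real p - J p"
      using inner_sum_difference[of p n] p by (simp add: J_def H_def)
    also have "- (real (p - 1) * (harm p / real p - J p))
        = real (p - 1) * J p - (harm p - harm p / real p)"
      unfolding p1 using p by (simp add: field_simps)
    finally show "(inner_sum n p * real p - inner_sum n p * (real p)^2
                  + inner_sum n (p - 1) * (real (p - 1))^2) * u^p
        = real (p - 1) * J p * u^p - (harm p * u^p - harm p / real p * u^p)"
      by (simp only: left_diff_distrib)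
  qed
  also have "\<dots> = S - (AH - AHk)"
    by (simp add: S_def AH_def AHk_def sum_subtractf)
  finally have D: "t * D1 - D2 = t * (S - (AH - AHk))" .

  \<comment> \<open>The factors \<open>u\<^sup>2\<close> and \<open>t\<^sup>q\<close> are moved with opaque \<open>A\<close>, \<open>B\<close>, \<open>C\<close>, so that the simplifier
    does not distribute over the finite sums.\<close>
  have cancel: "t * (u^2 * B * A + u^2 * C) / (t^2 * u^2) = (B * A + C) / t" for A B C
    using t0 u0 by (simp add: divide_simps) (simp add: algebra_simps power2_eq_square)
  have expand: "(B * A + C) / t = (t^q * B * A + t^q * C) / t^Suc q" for A B C
    using t0 by (simp add: field_simps)
  have "closed_form n t = (- t * (1 - t) * L + (t * L - t^2) * A1 - (4 * t * L - t * L^2) / 2 * A0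
      - L^2 / 2 * Ak + (2 * t - t * L) * AH + L * AkH - t * AHk + (t * D1 - D2)) / (1 - t)^2"
    unfolding closed_form_def f0_def f1_def f2_def f3_def f4_def f5_def
      u_def[symmetric] L_def[symmetric] A0_def[symmetric] A1_def[symmetric] Ak_def[symmetric]
      AH_def[symmetric] AkH_def[symmetric] AHk_def[symmetric] D1_def[symmetric] D2_def[symmetric]
    using t1 by (simp add: divide_simps) (simp add: algebra_simps power2_eq_square)
  also have "- t * (1 - t) * L + (t * L - t^2) * A1 - (4 * t * L - t * L^2) / 2 * A0
      - L^2 / 2 * Ak + (2 * t - t * L) * AH + L * AkH - t * AHk + (t * D1 - D2)
      = t * (U * (real n / 2 * L^2 + (t - real n * H) * L - t * H) + S)"
    unfolding D Ak AkH AH unfolding A0 by (simp add: field_simps power2_eq_square)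
  also have "(1 - t)^2 = t^2 * u^2"
    using ut by (metis power2_commute power_mult_distrib)
  also have "S = u^2 * (\<Sum>j=1..q. (real n - real j) / real j * (H - harm (j - 1)) * u^(q - j))"
  proof -
    have "S = (\<Sum>j=1..n. (real n - real j) / real j * (H - harm (j - 1)) * u^(Suc n - j))"
      unfolding S_def J_def
      by (rule sum.reindex_bij_witness[of _ "\<lambda>j. Suc n - j" "\<lambda>j. Suc n - j"])
         (auto simp: of_nat_diff Suc_diff_le)
    also have "\<dots> = (\<Sum>j=1..q. (real n - real j) / real j * (H - harm (j - 1)) * u^(Suc n - j))"
      by (simp add: n_def)
    also have "\<dots> = (\<Sum>j=1..q. u^2 * ((real n - real j) / real j * (H - harm (j - 1)) * u^(q - j)))"
      by (rule sum.cong) (auto simp: n_def Suc_diff_le power2_eq_square)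
    finally show ?thesis by (simp add: sum_distrib_left)
  qed
  also have "U = u^2 * u^q" by (simp add: U_def n_def power2_eq_square)
  finally have "closed_form n t = (u^q * (real n / 2 * L^2 + (t - real n * H) * L - t * H)
      + (\<Sum>j=1..q. (real n - real j) / real j * (H - harm (j - 1)) * u^(q - j))) / t"
    by (simp only: cancel)
  also have "\<dots> = (t^q * u^q * (real n / 2 * L^2 + (t - real n * H) * L - t * H)
      + (\<Sum>j=1..q. t^q * ((real n - real j) / real j * (H - harm (j - 1)) * u^(q - j)))) / t^Suc q"
    unfolding sum_distrib_left[symmetric] by (rule expand)
  also have "(\<Sum>j=1..q. t^q * ((real n - real j) / real j * (H - harm (j - 1)) * u^(q - j)))
      = (\<Sum>j=1..q. (real n - real j) / real j * (H - harm (j - 1)) * ((t - 1)^(q - j) * t^j))"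
  proof (rule sum.cong[OF refl])
    fix j assume "j \<in> {1..q}"
    hence "t^q = t^(q - j) * t^j" by (simp add: power_add[symmetric])
    thus "t^q * ((real n - real j) / real j * (H - harm (j - 1)) * u^(q - j))
        = (real n - real j) / real j * (H - harm (j - 1)) * ((t - 1)^(q - j) * t^j)"
      by (simp add: ut[symmetric] power_mult_distrib mult_ac)
  qed
  also have "t^q * u^q = (t - 1)^q" by (simp add: ut[symmetric] power_mult_distrib)
  finally show ?thesis
    by (simp add: primitive_def n_def H_def L_def)
qed

section \<open>The endpoint\<close>

text \<open>
  Nonnegativity serves as the Tauberian condition in this converse of Abel's theorem: each partial
  sum at \<open>1\<close> is the limit of partial sums that are at most \<open>f t\<close>, hence at most \<open>L\<close>, and
  conversely \<open>f t\<close> is at most the sum at \<open>1\<close>.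
\<close>

lemma sums_at_1_if_tendsto:
  fixes a :: "nat \<Rightarrow> real"
  assumes nonneg: "\<And>k. a k \<ge> 0"
    and sums: "\<And>t. 0 < t \<Longrightarrow> t < 1 \<Longrightarrow> (\<lambda>k. a k * t^k) sums f t"
    and lim: "(f \<longlongrightarrow> L) (at_left 1)"
  shows "a sums L"
proof -
  have ev: "\<forall>\<^sub>F t in at_left (1::real). 0 < t \<and> t < 1"
    using eventually_at_left_real[of 0 "1::real"] by (auto elim: eventually_mono)
  have partial: "(\<Sum>k<N. a k) \<le> L" for N
  proof (rule tendsto_le[OF _ lim])
    show "((\<lambda>t. \<Sum>k<N. a k * t^k) \<longlongrightarrow> (\<Sum>k<N. a k)) (at_left 1)"
      by (auto intro!: tendsto_eq_intros)
    show "\<forall>\<^sub>F t in at_left 1. (\<Sum>k<N. a k * t^k) \<le> f t"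
      using ev
    proof eventually_elim
      case (elim t)
      with sums[of t] nonneg show ?case
        using sum_le_suminf[of "\<lambda>k. a k * t^k" "{..<N}"] by (auto simp: sums_iff)
    qed
  qed auto
  have summ: "summable a"
    using nonneg partial by (intro summableI_nonneg_bounded[where x = L]) auto
  have "suminf a \<le> L"
    using partial summ by (intro suminf_le_const) auto
  moreover have "L \<le> suminf a"
  proof (rule tendsto_le[OF _ tendsto_const lim])
    show "\<forall>\<^sub>F t in at_left 1. f t \<le> suminf a"
      using ev
    proof eventually_elim
      case (elim t)
      have "a k * t^k \<le> a k" for k
        using elim nonneg[of k] by (intro mult_left_le power_le_one) auto
      with sums[of t] elim summ show ?case
        using suminf_le[of "\<lambda>k. a k * t^k" a] by (auto simp: sums_iff)
    qed
  qed auto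
  ultimately show ?thesis using summ by (auto simp: sums_iff)
qed

lemma primitive_Suc_tendsto:
  "\<exists>L. (primitive (Suc q) \<longlongrightarrow> L) (at_left 1)"
proof -
  have a: "((\<lambda>z::real. (z - 1) * (ln (1 - z))^2) \<longlongrightarrow> 0) (at_left 1)" by real_asymp
  have b: "((\<lambda>z::real. (z - 1) * ln (1 - z)) \<longlongrightarrow> 0) (at_left 1)" by real_asymp
  \<comment> \<open>One factor \<open>z - 1\<close> is given to each logarithmic term to make it tend to \<open>0\<close>.\<close>
  have eq: "primitive (Suc q) = (\<lambda>z. (z - 1)^q * (real (Suc (Suc q)) / 2 * ((z - 1) * (ln (1 - z))^2)
       + (z - real (Suc (Suc q)) * harm (Suc (Suc q))) * ((z - 1) * ln (1 - z)) - (z - 1) * (z * harm (Suc (Suc q))))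
     + (\<Sum>j=1..Suc q. (real (Suc (Suc q)) - real j) / real j * (harm (Suc (Suc q)) - harm (j - 1))
                   * ((z - 1)^(Suc q - j) * z^j)))"
    by (rule ext)
       (simp add: primitive_def algebra_simps add_divide_distrib diff_divide_distrib del: of_nat_Suc)
  show ?thesis
    unfolding eq by (intro exI) (rule tendsto_intros a b)+
qed

theorem theorem2p13:
  fixes n :: nat and t :: real
  assumes "n \<ge> 1"
    and "0 < t"
    and "n = 1 \<Longrightarrow> t < 1"
    and "n \<ge> 2 \<Longrightarrow> t \<le> 1"
  shows "(t < 1 \<longrightarrow> (\<lambda>k. series_term n t (Suc k)) sums closed_form n t) \<and>
         (t = 1 \<longrightarrow> (\<exists>L. (closed_form n \<longlongrightarrow> L) (at_left 1) \<and>
                           (\<lambda>k. series_term n t (Suc k)) sums L))"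
proof -
  obtain q where n: "n = Suc q" using assms(1) by (cases n) auto
  have below_1: "(\<lambda>k. series_term n x (Suc k)) sums closed_form n x" if "0 < x" "x < 1" for x
    using sums_series_term[OF that] closed_form_eq_primitive[OF that] by (simp add: n)
  show ?thesis
  proof (intro conjI impI)
    assume "t < 1" with assms(2) show "(\<lambda>k. series_term n t (Suc k)) sums closed_form n t"
      by (rule below_1)
  next
    assume t: "t = 1"
    with assms(3) n obtain r where r: "q = Suc r" by (cases q) auto
    obtain M where M: "(primitive q \<longlongrightarrow> M) (at_left 1)"
      using primitive_Suc_tendsto[of r] r by auto
    have lim': "((\<lambda>x. primitive q x / x^n) \<longlongrightarrow> M / 1^n) (at_left 1)"
      by (intro tendsto_intros M) auto
    have ev: "\<forall>\<^sub>F x in at_left (1::real). primitive q x / x^n = closed_form n x"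
      using eventually_at_left_real[of 0 "1::real"]
      by (auto elim!: eventually_mono simp: closed_form_eq_primitive n)
    have lim: "(closed_form n \<longlongrightarrow> M) (at_left 1)"
      using Lim_transform_eventually[OF lim' ev] by simp
    have "(\<lambda>k. series_term n 1 (Suc k)) sums M"
      \<comment> \<open>The series starts with \<open>t\<^sup>1\<close>, so one factor \<open>x\<close> is divided out to obtain a power series.\<close>
    proof (rule sums_at_1_if_tendsto)
      show "series_term n 1 (Suc k) \<ge> 0" for k
        by (simp add: series_term_def harm_nonneg)
      show "((\<lambda>x. closed_form n x / x) \<longlongrightarrow> M) (at_left 1)"
        using tendsto_divide[OF lim tendsto_ident_at] by simp
      show "(\<lambda>k. series_term n 1 (Suc k) * x^k) sums (closed_form n x / x)" if "0 < x" "x < 1" for x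
        using sums_divide[OF below_1[OF that], of x] that by (simp add: series_term_def)
    qed
    with lim t show "\<exists>L. (closed_form n \<longlongrightarrow> L) (at_left 1) \<and> (\<lambda>k. series_term n t (Suc k)) sums L"
      by auto
  qed
qed

end
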